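(* Let $\mathcal{R} = (r_i)_{i \in I}$ be an infinite pre-Rademacher family in a Boolean algebra $\mathcal{B}$. Then: (1) for every nonzero element $a$ of $\mathcal{B}_\tau(\mathcal{R})$ the following assertions are equivalent: (a) $a$ is an atom in $\mathcal{B}_\tau(\mathcal{R})$; (b) there is a collection of signs $(\overline{\theta}_i)_{i \in I}$ such that $a = \bigcap_{i \in I} \overline{\theta}_i r_i$; (2) the following assertions are equivalent: (a) $\mathcal{B}_\tau(\mathcal{R})$ is atomless; (b) for every collection of signs $\theta_i = \pm 1$, $i\in I$, either $\bigcap_{i \in I} \theta_i r_i = \mathbf{0}$ or $\bigcap_{i \in I} \theta_i r_i$ does not exist.
   Context: A Boolean algebra $\mathcal{B}$ has zero $\mathbf{0}$, unit $\mathbf{1}$ and order $x \leq y \iff x \cap y = x$; the intersection of an infinite family denotes its infimum in $\mathcal{B}$, when it exists. For $x \in \mathcal{B}$ and a sign $\theta \in \{-1,1\}$ put $1x = x$ and $-1x = -x = \mathbf{1}\setminus x$. A subalgebra $\mathcal{A}$ of $\mathcal{B}$ (containing $\mathbf{1}$) is order closed if for every $C \subseteq \mathcal{A}$ whose supremum exists in $\mathcal{B}$ one has $\sup C \in \mathcal{A}$. $\mathcal{B}_\tau(\mathcal{R})$ is the smallest order closed subalgebra of $\mathcal{B}$ including $\mathcal{R}$. A family $\mathcal{R} = (r_i)_{i\in I}$ in $\mathcal{B}$ is a pre-Rademacher family if $\bigcap_{j\in J}\theta_j r_j \neq \mathbf{0}$ for every finite $J \subseteq I$ and all signs $\theta_j=\pm1$,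 $j\in J$. A nonzero element $a$ of a Boolean algebra is an atom if every $x\leq a$ in the algebra equals $\mathbf{0}$ or $a$; the algebra is atomless if it has no atoms. *)

theory Defs
  imports Main "HOL-Library.FuncSet" "HOL-Library.Lub_Glb"
begin

definition signed :: "int \<Rightarrow> 'a::boolean_algebra \<Rightarrow> 'a" where
  "signed \<theta> x = (if \<theta> = -1 then - x else x)"

text \<open>The finite meet is taken over the family with \<^term>\<open>top\<close> adjoined, so that the empty meet is
  \<^term>\<open>top\<close> (\<^const>\<open>Inf_fin\<close> is unspecified on the empty set).\<close>

definition pre_Rademacher :: "'i set \<Rightarrow> ('i \<Rightarrow> 'a::boolean_algebra) \<Rightarrow> bool" where
  "pre_Rademacher I r \<longleftrightarrow>
     (\<forall>J \<theta>. finite J \<and> J \<subseteq> I \<and> \<theta> \<in> J \<rightarrow> {-1, 1} \<longrightarrow>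
        Inf_fin (insert top ((\<lambda>j. signed (\<theta> j) (r j)) ` J)) \<noteq> bot)"

definition subalgebra :: "'a::boolean_algebra set \<Rightarrow> bool" where
  "subalgebra A \<longleftrightarrow> bot \<in> A \<and> top \<in> A \<and> (\<forall>x\<in>A. - x \<in> A) \<and>
     (\<forall>x\<in>A. \<forall>y\<in>A. inf x y \<in> A \<and> sup x y \<in> A)"

text \<open>\<^term>\<open>isLub UNIV C s\<close> says that \<open>s\<close> is the supremum of \<open>C\<close> in the whole algebra,
  not merely relative to \<open>A\<close>.\<close>

definition order_closed_subalgebra :: "'a::boolean_algebra set \<Rightarrow> bool" where
  "order_closed_subalgebra A \<longleftrightarrow> subalgebra A \<and>
     (\<forall>C s. C \<subseteq> A \<and> isLub UNIV C s \<longrightarrow> s \<in> A)"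

definition order_closed_hull :: "'a::boolean_algebra set \<Rightarrow> 'a set" where
  "order_closed_hull R = \<Inter> {A. order_closed_subalgebra A \<and> R \<subseteq> A}"

lemma order_closed_subalgebra_hull: "order_closed_subalgebra (order_closed_hull R)"
  unfolding order_closed_hull_def order_closed_subalgebra_def subalgebra_def by blast

lemma order_closed_hull_superset: "R \<subseteq> order_closed_hull R"
  unfolding order_closed_hull_def by blast

lemma order_closed_hull_least:
  "order_closed_subalgebra A \<Longrightarrow> R \<subseteq> A \<Longrightarrow> order_closed_hull R \<subseteq> A"
  unfolding order_closed_hull_def by blast

definition atom_in :: "'a::boolean_algebra set \<Rightarrow> 'a \<Rightarrow> bool" where
  "atom_in A a \<longleftrightarrow> a \<in> A \<and> a \<noteq> bot \<and> (\<forall>x\<in>A. x \<le> a \<longrightarrow> x = bot \<or> x = a)"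

definition atomless :: "'a::boolean_algebra set \<Rightarrow> bool" where
  "atomless A \<longleftrightarrow> \<not> (\<exists>a. atom_in A a)"

text \<open>\<open>is_meet I f a\<close>: the infimum of the family \<open>f\<close> over \<open>I\<close> exists in the whole algebra
  and equals \<open>a\<close>.\<close>

definition is_meet :: "'i set \<Rightarrow> ('i \<Rightarrow> 'a::boolean_algebra) \<Rightarrow> 'a \<Rightarrow> bool" where
  "is_meet I f a \<longleftrightarrow> isGlb UNIV (f ` I) a"

end

(* For fixed u, the elements x with u <= x or u <= -x form an order closed
   subalgebra. If it contains all r_i, it contains the whole hull, so the hull cannot split u.
   With u a nonzero signed meet, this makes u an atom. With u the join of an atom a and a lower
   bound x of the signed r_i determined by a, it gives x <= a, so a is the signed meet. *)

theory Submission imports Defs begin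

lemma isLub_UNIV_iff:
  fixes s :: "'a::order"
  shows "isLub UNIV C s \<longleftrightarrow> (\<forall>c\<in>C. c \<le> s) \<and> (\<forall>u. (\<forall>c\<in>C. c \<le> u) \<longrightarrow> s \<le> u)"
  by (auto simp: isLub_def leastP_def isUb_def setle_def setge_def)

lemma isGlb_UNIV_iff:
  fixes s :: "'a::order"
  shows "isGlb UNIV C s \<longleftrightarrow> (\<forall>c\<in>C. s \<le> c) \<and> (\<forall>u. (\<forall>c\<in>C. u \<le> c) \<longrightarrow> u \<le> s)"
  by (auto simp: isGlb_def greatestP_def isLb_def setle_def setge_def)

lemma is_meet_iff:
  "is_meet I f a \<longleftrightarrow> (\<forall>i\<in>I. a \<le> f i) \<and> (\<forall>x. (\<forall>i\<in>I. x \<le> f i) \<longrightarrow> x \<le> a)"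
  by (simp add: is_meet_def isGlb_UNIV_iff)

lemma is_meet_unique:
  assumes "is_meet I f a" and "is_meet I f b"
  shows "a = b"
  using assms by (meson is_meet_iff order.antisym)

lemma le_and_le_compl_imp_bot:
  fixes x :: "'a::boolean_algebra"
  assumes "x \<le> y" and "x \<le> - y"
  shows "x = bot"
  using le_infI[OF assms] by (simp add: bot_unique)

text \<open>The condition is symmetric in \<open>x\<close> and \<open>- x\<close>, which gives
  closure under complements. For a supremum \<open>s\<close> of \<open>C\<close>: if some
  \<open>c\<close> in \<open>C\<close> lies above \<open>u\<close>, so does \<open>s\<close>;
  otherwise \<open>- u\<close> is an upper bound of \<open>C\<close>, hence of
  \<open>s\<close>.\<close>

lemma order_closed_subalgebra_undivided:
  fixes u :: "'a::boolean_algebra"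
  shows "order_closed_subalgebra {x. u \<le> x \<or> u \<le> - x}"
proof -
  have "u \<le> s \<or> u \<le> - s"
    if C: "C \<subseteq> {x. u \<le> x \<or> u \<le> - x}" and s: "isLub UNIV C s" for C s
  proof (cases "\<exists>c\<in>C. u \<le> c")
    case True
    then show ?thesis
      using s by (meson isLub_UNIV_iff order_trans)
  next
    case False
    with C have "\<forall>c\<in>C. u \<le> - c" by blast
    then have "\<forall>c\<in>C. c \<le> - u" by (simp add: compl_le_swap1)
    with s have "s \<le> - u" by (simp add: isLub_UNIV_iff)
    then show ?thesis by (simp add: compl_le_swap1)
  qed
  moreover have "subalgebra {x. u \<le> x \<or> u \<le> - x}"
    unfolding subalgebra_def by (auto intro: le_supI1 le_supI2 le_infI1 le_infI2)
  ultimately show ?thesis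
    unfolding order_closed_subalgebra_def by blast
qed

text \<open>Minimality of the hull stands in for an induction over its generation: not being split
  by the generators passes to every element.\<close>

lemma order_closed_hull_undivided:
  assumes "\<And>y. y \<in> R \<Longrightarrow> u \<le> y \<or> u \<le> - y" and "x \<in> order_closed_hull R"
  shows "u \<le> x \<or> u \<le> - x"
  using order_closed_hull_least[OF order_closed_subalgebra_undivided, of R u] assms by blast

text \<open>Order closedness speaks of suprema only. By De Morgan, \<open>- a\<close> is the
  supremum of the complements \<open>- f i\<close>.\<close>

lemma order_closed_subalgebra_is_meet:
  assumes A: "order_closed_subalgebra A" and f: "\<And>i. i \<in> I \<Longrightarrow> f i \<in> A" and a: "is_meet I f a"
  shows "a \<in> A"
proof -
  have "isLub UNIV ((\<lambda>i. - f i) ` I) (- a)"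
    using a by (auto simp: isLub_UNIV_iff is_meet_iff compl_le_swap2)
  moreover have "(\<lambda>i. - f i) ` I \<subseteq> A"
    using A f by (auto simp: order_closed_subalgebra_def subalgebra_def)
  ultimately have "- a \<in> A"
    using A unfolding order_closed_subalgebra_def by blast
  then have "- (- a) \<in> A"
    using A unfolding order_closed_subalgebra_def subalgebra_def by blast
  then show ?thesis by simp
qed

lemma signed_meet_in_order_closed_hull:
  assumes "is_meet I (\<lambda>i. signed (\<theta> i) (r i)) a"
  shows "a \<in> order_closed_hull (r ` I)"
proof (rule order_closed_subalgebra_is_meet[OF order_closed_subalgebra_hull _ assms])
  fix i assume "i \<in> I"
  then have "r i \<in> order_closed_hull (r ` I)"
    using order_closed_hull_superset by blast
  then show "signed (\<theta> i) (r i) \<in> order_closed_hull (r ` I)"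
    using order_closed_subalgebra_hull[of "r ` I"]
    by (simp add: signed_def order_closed_subalgebra_def subalgebra_def)
qed

text \<open>\<open>signed\<close> counts every integer other than -1 as +1, so its value is
  \<open>x\<close> or \<open>- x\<close> for any \<open>\<theta>\<close>.\<close>

lemma le_signed_imp: "u \<le> signed \<theta> x \<Longrightarrow> u \<le> x \<or> u \<le> - x"
  by (auto simp: signed_def split: if_splits)

lemma signed_meet_imp_atom_in:
  assumes a: "is_meet I (\<lambda>i. signed (\<theta> i) (r i)) a" and "a \<noteq> bot"
  shows "atom_in (order_closed_hull (r ` I)) a"
proof -
  have "x = bot \<or> x = a" if x: "x \<in> order_closed_hull (r ` I)" "x \<le> a" for x
  proof -
    have "a \<le> y \<or> a \<le> - y" if "y \<in> r ` I" for y
      using that a by (auto simp: is_meet_iff dest: le_signed_imp)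
    then have "a \<le> x \<or> a \<le> - x"
      using order_closed_hull_undivided x(1) by blast
    then show ?thesis
    proof
      assume "a \<le> x"
      with x(2) show ?thesis by simp
    next
      assume "a \<le> - x"
      with x(2) have "x \<le> - x" by (rule order_trans)
      then show ?thesis using le_and_le_compl_imp_bot[of x x] by simp
    qed
  qed
  then show ?thesis
    using assms signed_meet_in_order_closed_hull unfolding atom_in_def by blast
qed

lemma atom_in_imp_signed_meet:
  assumes a: "atom_in (order_closed_hull (r ` I)) a"
  shows "\<exists>\<theta> \<in> I \<rightarrow> {-1, 1}. is_meet I (\<lambda>i. signed (\<theta> i) (r i)) a"
proof -
  let ?A = "order_closed_hull (r ` I)"
  have aA: "a \<in> ?A" and a_nz: "a \<noteq> bot"
    and a_min: "\<And>x. x \<in> ?A \<Longrightarrow> x \<le> a \<Longrightarrow> x = bot \<or> x = a"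
    using a by (auto simp: atom_in_def)
  have below: "a \<le> r i \<or> a \<le> - r i" if "i \<in> I" for i
  proof -
    have "r i \<in> ?A" using order_closed_hull_superset that by blast
    with aA have "inf a (r i) \<in> ?A"
      using order_closed_subalgebra_hull[of "r ` I"]
      by (simp add: order_closed_subalgebra_def subalgebra_def)
    then have "inf a (r i) = bot \<or> inf a (r i) = a"
      using a_min by simp
    then show ?thesis
      \<comment> \<open>A zero meet with \<open>r i\<close> means \<open>a \<le> - r i\<close>; a
        meet equal to \<open>a\<close> means \<open>a \<le> r i\<close>.\<close>
      by (metis inf.absorb_iff1 inf_shunt)
  qed
  define \<theta> :: "_ \<Rightarrow> int" where "\<theta> = (\<lambda>i. if a \<le> r i then 1 else -1)"
  have a_le: "a \<le> signed (\<theta> i) (r i)" if "i \<in> I" for i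
    using below[OF that] by (auto simp: \<theta>_def signed_def)
  have "x \<le> a" if x: "\<forall>i\<in>I. x \<le> signed (\<theta> i) (r i)" for x
  proof -
    \<comment> \<open>The lower bound \<open>x\<close> ranges over the whole algebra and need not
      lie in the hull, so minimality of \<open>a\<close> does not apply to it. Joining
      \<open>a\<close> to it also excludes the second alternative below:
      \<open>sup x a \<le> - a\<close> would give \<open>a \<le> - a\<close>, hence
      \<open>a = bot\<close>.\<close>
    have "sup x a \<le> y \<or> sup x a \<le> - y" if "y \<in> r ` I" for y
      using that x a_le le_signed_imp by (metis imageE le_supI)
    then have "sup x a \<le> a \<or> sup x a \<le> - a"
      using order_closed_hull_undivided aA by blast
    then show ?thesis
      using le_and_le_compl_imp_bot[of a a] a_nz by auto
  qed
  with a_le have "is_meet I (\<lambda>i. signed (\<theta> i) (r i)) a"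
    by (simp add: is_meet_iff)
  moreover have "\<theta> \<in> I \<rightarrow> {-1, 1}" by (simp add: \<theta>_def)
  ultimately show ?thesis by blast
qed

theorem theorem2p10:
  fixes I :: "'i set" and r :: "'i \<Rightarrow> 'a::boolean_algebra"
  assumes "infinite I" and "pre_Rademacher I r"
  shows "(\<forall>a \<in> order_closed_hull (r ` I). a \<noteq> bot \<longrightarrow>
            (atom_in (order_closed_hull (r ` I)) a \<longleftrightarrow>
             (\<exists>\<theta> \<in> I \<rightarrow> {-1, 1}. is_meet I (\<lambda>i. signed (\<theta> i) (r i)) a)))
       \<and> (atomless (order_closed_hull (r ` I)) \<longleftrightarrow>
          (\<forall>\<theta> \<in> I \<rightarrow> {-1, 1}.
             is_meet I (\<lambda>i. signed (\<theta> i) (r i)) bot \<or>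
             \<not> (\<exists>a. is_meet I (\<lambda>i. signed (\<theta> i) (r i)) a)))"
proof -
  have atom_iff: "atom_in (order_closed_hull (r ` I)) a \<longleftrightarrow>
      a \<noteq> bot \<and> (\<exists>\<theta> \<in> I \<rightarrow> {-1, 1}. is_meet I (\<lambda>i. signed (\<theta> i) (r i)) a)" for a
    using atom_in_imp_signed_meet[of r I a] signed_meet_imp_atom_in[of I _ r a]
    by (auto simp: atom_in_def)
  have ex_atom: "(\<exists>a. atom_in (order_closed_hull (r ` I)) a) \<longleftrightarrow>
      (\<exists>\<theta> \<in> I \<rightarrow> {-1, 1}. \<exists>a. a \<noteq> bot \<and> is_meet I (\<lambda>i. signed (\<theta> i) (r i)) a)"
    by (auto simp: atom_iff)
  \<comment> \<open>Infima are unique, so a zero infimum rules out a nonzero one. This turns the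
    dichotomy of the second claim into the negation of the right-hand side of
    \<open>ex_atom\<close>.\<close>
  have meet_iff: "(is_meet I f bot \<or> \<not> (\<exists>a. is_meet I f a)) \<longleftrightarrow> \<not> (\<exists>a. a \<noteq> bot \<and> is_meet I f a)"
    for f :: "'i \<Rightarrow> 'a"
    using is_meet_unique[of I f] by metis
  show ?thesis
    unfolding atomless_def ex_atom meet_iff by (simp add: atom_iff)
qed

end
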